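(* The variety $\mathbb{V}(\mathrm{mSt})$ of monoids generated by the meet-stalactic monoid $\mathrm{mSt}$ admits a finite equational basis, consisting of the identities $$xzxyty \approx xzyxty, \qquad xzxytx \approx xzyxtx,$$ where $x,y,z,t$ are distinct variables.
   Context: With $\mathbb{N}=\{1,2,\dots\}$, the meet-stalactic monoid is $\mathrm{mSt}=\mathbb{N}^*/{\equiv_{\mathrm{mSt}}}$, where $u\equiv_{\mathrm{mSt}}v$ iff every letter occurs the same number of times in $u$ and $v$, the order of the first occurrences of the letters (reading left to right) is the same in $u$ and $v$, and the order of the last occurrences of the letters (reading left to right) is the same in $u$ and $v$. Identities are formal equalities $u\approx v$ of words over an alphabet of variables $\mathcal{X}$; a monoid $M$ satisfies $u\approx v$ if $\psi(u)=\psi(v)$ for every monoid morphism $\psi:\mathcal{X}^*\to M$ (so variables may be sent to the identity element). The equational theory of a variety is the set of identities satisfied by all its members (for $\mathbb{V}(M)$ it is the set of identities satisfied by $M$). An equational basis of a variety is a subset $\mathcal{B}$ of its equational theory such that every identity of the equational theory is a consequence of $\mathcal{B}$, i.e. lies in the equational theory (fully invariant congruence on $\mathcal{X}^*$) generated by $\mathcal{B}$. *)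

theory Defs
  imports "HOL-Algebra.Product_Groups"
begin

section \<open>Monoid morphisms, free monoids, and the meet-stalactic monoid\<close>

text \<open>\<open>hom\<close> of HOL-Algebra only asks for compatibility with multiplication.\<close>

definition monoid_hom :: "('a, 'm) monoid_scheme \<Rightarrow> ('b, 'n) monoid_scheme \<Rightarrow> ('a \<Rightarrow> 'b) set" where
  "monoid_hom M N = {f \<in> hom M N. f \<one>\<^bsub>M\<^esub> = \<one>\<^bsub>N\<^esub>}"

definition free_monoid :: "'v set \<Rightarrow> 'v list monoid" where
  "free_monoid A = \<lparr>carrier = lists A, monoid.mult = (@), one = []\<rparr>"

text \<open>The list of letters of a word in the order of their first, respectively last, occurrences;
  \<open>remdups\<close> keeps the last copy of every element.\<close>

definition first_occurrences :: "'a list \<Rightarrow> 'a list" where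
  "first_occurrences u = rev (remdups (rev u))"

definition last_occurrences :: "'a list \<Rightarrow> 'a list" where
  "last_occurrences u = remdups u"

definition mst_cong :: "(nat list \<times> nat list) set" where
  "mst_cong = {(u, v). u \<in> lists {1..} \<and> v \<in> lists {1..} \<and>
     (\<forall>a. count_list u a = count_list v a) \<and>
     first_occurrences u = first_occurrences v \<and>
     last_occurrences u = last_occurrences v}"

text \<open>The set product of two classes need not be a class, hence the outer closure under
  \<open>mst_cong\<close>; see \<open>mSt_mult\<close> below.\<close>

definition mSt :: "nat list set monoid" where
  "mSt = \<lparr>carrier = lists {1..} // mst_cong,
          monoid.mult = (\<lambda>A B. \<Union>a\<in>A. \<Union>b\<in>B. mst_cong `` {a @ b}),
          one = mst_cong `` {[]}\<rparr>"

lemma equiv_mst_cong: "equiv (lists {1..}) mst_cong"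
  by (auto simp: mst_cong_def equiv_def refl_on_def sym_def trans_def)

lemma mst_cong_append:
  assumes "(u, u') \<in> mst_cong" "(v, v') \<in> mst_cong"
  shows "(u @ v, u' @ v') \<in> mst_cong"
proof -
  have append: "remdups (a @ b) = filter (\<lambda>x. x \<notin> set b) (remdups a) @ remdups b" for a b :: "nat list"
    by (induction a) auto
  have *: "remdups (a @ b) = remdups (a' @ b')"
    if "remdups a = remdups a'" "remdups b = remdups b'" for a a' b b' :: "nat list"
    using append[of a b] append[of a' b'] that by (metis set_remdups)
  show ?thesis
    using assms *[of u u' v v'] *[of "rev v" "rev v'" "rev u" "rev u'"]
    by (simp add: mst_cong_def first_occurrences_def last_occurrences_def)
qed

lemma mSt_mult:
  assumes "u \<in> lists {1..}" "v \<in> lists {1..}"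
  shows "mst_cong `` {u} \<otimes>\<^bsub>mSt\<^esub> mst_cong `` {v} = mst_cong `` {u @ v}"
proof -
  have "mst_cong `` {a @ b} = mst_cong `` {u @ v}"
    if "a \<in> mst_cong `` {u}" "b \<in> mst_cong `` {v}" for a b
  proof -
    from that have "(u @ v, a @ b) \<in> mst_cong"
      by (intro mst_cong_append) auto
    then show ?thesis
      using equiv_class_eq[OF equiv_mst_cong] by fastforce
  qed
  moreover have nonempty: "mst_cong `` {u} \<noteq> {}" "mst_cong `` {v} \<noteq> {}"
    using assms equiv_class_self[OF equiv_mst_cong] by blast+
  ultimately have "(\<Union>a\<in>mst_cong `` {u}. \<Union>b\<in>mst_cong `` {v}. mst_cong `` {a @ b}) =
      (\<Union>a\<in>mst_cong `` {u}. \<Union>b\<in>mst_cong `` {v}. mst_cong `` {u @ v})"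
    by (intro SUP_cong refl) blast
  also have "\<dots> = mst_cong `` {u @ v}"
    using nonempty by (simp only: UN_constant if_False)
  finally show ?thesis
    by (simp add: mSt_def)
qed

lemma mSt_monoid: "monoid mSt"
proof -
  have ex: "\<exists>u\<in>lists {1..}. A = mst_cong `` {u}" if "A \<in> carrier mSt" for A
    using that by (auto simp: mSt_def quotient_def)
  have cl: "mst_cong `` {u} \<in> carrier mSt" if "u \<in> lists {1..}" for u
    using that by (auto simp: mSt_def quotient_def)
  have one: "\<one>\<^bsub>mSt\<^esub> = mst_cong `` {[]}"
    by (simp add: mSt_def)
  show ?thesis
  proof (rule monoidI)
    fix A B assume "A \<in> carrier mSt" "B \<in> carrier mSt"
    then obtain u v where "u \<in> lists {1..}" "A = mst_cong `` {u}"
      "v \<in> lists {1..}" "B = mst_cong `` {v}" using ex by metis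
    then show "A \<otimes>\<^bsub>mSt\<^esub> B \<in> carrier mSt"
      using cl[of "u @ v"] mSt_mult[of u v] by simp
  next
    show "\<one>\<^bsub>mSt\<^esub> \<in> carrier mSt" using cl[of "[]"] one by simp
  next
    fix A B C assume "A \<in> carrier mSt" "B \<in> carrier mSt" "C \<in> carrier mSt"
    then obtain u v w where "u \<in> lists {1..}" "A = mst_cong `` {u}"
      "v \<in> lists {1..}" "B = mst_cong `` {v}"
      "w \<in> lists {1..}" "C = mst_cong `` {w}" using ex by metis
    then show "A \<otimes>\<^bsub>mSt\<^esub> B \<otimes>\<^bsub>mSt\<^esub> C = A \<otimes>\<^bsub>mSt\<^esub> (B \<otimes>\<^bsub>mSt\<^esub> C)"
      using mSt_mult[of u v] mSt_mult[of v w] mSt_mult[of "u @ v" w] mSt_mult[of u "v @ w"] by simp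
  next
    fix A assume "A \<in> carrier mSt"
    then obtain u where u: "u \<in> lists {1..}" "A = mst_cong `` {u}" using ex by metis
    show "\<one>\<^bsub>mSt\<^esub> \<otimes>\<^bsub>mSt\<^esub> A = A" using u mSt_mult[of "[]" u] one by simp
    show "A \<otimes>\<^bsub>mSt\<^esub> \<one>\<^bsub>mSt\<^esub> = A" using u mSt_mult[of u "[]"] one by simp
  qed
qed


section \<open>Varieties and identities\<close>

text \<open>The variety generated by \<open>M\<close>, by Birkhoff and Tarski: the monoids that are homomorphic images
  of submonoids of direct powers of \<open>M\<close>. (\<open>product_group\<close> is the plain direct product, also for
  monoids.) The members have carriers in a type \<open>'b\<close>. Exponents \<open>I\<close> in the type \<open>'b \<Rightarrow> 'a\<close>
  suffice: the free object of the variety over \<open>'b\<close>, of which every member with carrier in \<open>'b\<close>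
  is an image, embeds into the power of \<open>M\<close> indexed by the valuations of \<open>'b\<close> in \<open>M\<close>.\<close>

definition variety :: "('a, 'm) monoid_scheme \<Rightarrow> 'b monoid set" where
  "variety M = {N. monoid N \<and>
     (\<exists>(I :: ('b \<Rightarrow> 'a) set) S f.
        submonoid S (product_group I (\<lambda>_. M)) \<and>
        f \<in> monoid_hom ((product_group I (\<lambda>_. M))\<lparr>carrier := S\<rparr>) N \<and>
        f ` S = carrier N)}"

text \<open>The alphabet of variables is the whole type \<open>'v\<close>; the identity \<open>u \<approx> v\<close> is the pair \<open>(u, v)\<close>.\<close>

definition satisfies :: "('a, 'm) monoid_scheme \<Rightarrow> 'v list \<times> 'v list \<Rightarrow> bool" where
  "satisfies M e \<longleftrightarrow> (\<forall>\<psi> \<in> monoid_hom (free_monoid UNIV) M. \<psi> (fst e) = \<psi> (snd e))"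

definition equational_theory :: "('a, 'm) monoid_scheme set \<Rightarrow> ('v list \<times> 'v list) set" where
  "equational_theory K = {e. \<forall>M\<in>K. satisfies M e}"

definition fully_invariant_congruence :: "('v list \<times> 'v list) set \<Rightarrow> bool" where
  "fully_invariant_congruence R \<longleftrightarrow> equiv UNIV R \<and>
     (\<forall>u u' v v'. (u, u') \<in> R \<longrightarrow> (v, v') \<in> R \<longrightarrow> (u @ v, u' @ v') \<in> R) \<and>
     (\<forall>\<phi> \<in> monoid_hom (free_monoid UNIV) (free_monoid UNIV).
        \<forall>u v. (u, v) \<in> R \<longrightarrow> (\<phi> u, \<phi> v) \<in> R)"

definition consequences :: "('v list \<times> 'v list) set \<Rightarrow> ('v list \<times> 'v list) set" where
  "consequences B = \<Inter> {R. fully_invariant_congruence R \<and> B \<subseteq> R}"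

definition equational_basis ::
    "('a, 'm) monoid_scheme set \<Rightarrow> ('v list \<times> 'v list) set \<Rightarrow> bool" where
  "equational_basis V B \<longleftrightarrow>
     B \<subseteq> equational_theory V \<and> equational_theory V \<subseteq> consequences B"

text \<open>Every member of \<open>variety M\<close>, over any carrier type, satisfies the identities of \<open>M\<close>; and
  the members over the carrier type of \<open>M\<close>, which include \<open>M\<close>, already determine the
  equational theory.\<close>

lemma equational_theory_variety_superset:
  fixes M :: "'a monoid"
  assumes M: "monoid M"
  shows "equational_theory {M} \<subseteq> (equational_theory (variety M :: 'b monoid set) :: ('v list \<times> 'v list) set)"
proof
  fix e :: "'v list \<times> 'v list" assume e: "e \<in> equational_theory {M}"
  have "satisfies N e" if "N \<in> variety M" for N :: "'b monoid"
  proof -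
    from that obtain I :: "('b \<Rightarrow> 'a) set" and S f where
      N: "monoid N" and S: "submonoid S (product_group I (\<lambda>_. M))" and
      f: "f \<in> monoid_hom ((product_group I (\<lambda>_. M))\<lparr>carrier := S\<rparr>) N" and
      onto: "f ` S = carrier N" unfolding variety_def by blast
    interpret M: monoid M by (rule M)
    interpret S: submonoid S "product_group I (\<lambda>_. M)" by (rule S)
    let ?P = "product_group I (\<lambda>_. M)"
    have fmult: "f (a \<otimes>\<^bsub>?P\<^esub> b) = f a \<otimes>\<^bsub>N\<^esub> f b" if "a \<in> S" "b \<in> S" for a b
      using f that by (auto simp: monoid_hom_def hom_def)
    have fone: "f \<one>\<^bsub>?P\<^esub> = \<one>\<^bsub>N\<^esub>"
      using f by (auto simp: monoid_hom_def)
    show ?thesis unfolding satisfies_def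
    proof
      fix \<psi> :: "'v list \<Rightarrow> 'b" assume psi: "\<psi> \<in> monoid_hom (free_monoid UNIV) N"
      have psi_app: "\<psi> (u @ v) = \<psi> u \<otimes>\<^bsub>N\<^esub> \<psi> v" for u v
        using psi by (auto simp: monoid_hom_def hom_def free_monoid_def)
      have psi_nil: "\<psi> [] = \<one>\<^bsub>N\<^esub>"
        using psi by (auto simp: monoid_hom_def free_monoid_def)
      have psi_in: "\<psi> u \<in> f ` S" for u
        using psi onto by (auto simp: monoid_hom_def hom_def free_monoid_def)
      define g where "g x = (SOME s. s \<in> S \<and> f s = \<psi> [x])" for x
      have g: "g x \<in> S" "f (g x) = \<psi> [x]" for x
      proof -
        have "\<exists>s. s \<in> S \<and> f s = \<psi> [x]" using psi_in[of "[x]"] by force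
        from someI_ex[OF this] show "g x \<in> S" "f (g x) = \<psi> [x]" by (auto simp: g_def)
      qed
      define h where "h u = foldr (\<lambda>x s. g x \<otimes>\<^bsub>?P\<^esub> s) u \<one>\<^bsub>?P\<^esub>" for u
      have h_simps: "h [] = \<one>\<^bsub>?P\<^esub>" "h (x # u) = g x \<otimes>\<^bsub>?P\<^esub> h u" for x u
        by (simp_all add: h_def)
      have h_in: "h u \<in> S" for u
        by (induction u) (simp_all only: h_simps S.one_closed S.m_closed g)
      have fh: "f (h u) = \<psi> u" for u
      proof (induction u)
        case Nil
        then show ?case by (simp only: h_simps fone psi_nil)
      next
        case (Cons x u)
        then show ?case
          using psi_app[of "[x]" u] by (simp only: h_simps fmult[OF g(1) h_in] g) simp
      qed
      have "h (fst e) = h (snd e)"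
      proof (rule extensionalityI[where A = I])
        show "h (fst e) \<in> extensional I" "h (snd e) \<in> extensional I"
          using h_in S.subset by (auto simp: PiE_def)
      next
        fix i assume i: "i \<in> I"
        have coord: "s i \<in> carrier M" if "s \<in> S" for s
          using that i S.subset by (auto simp: PiE_def)
        have gM: "g x i \<in> carrier M" for x
          using coord g by blast
        have "(\<lambda>u. h u i) \<in> monoid_hom (free_monoid UNIV) M"
        proof -
          have h_app: "h (u @ v) i = h u i \<otimes>\<^bsub>M\<^esub> h v i" for u v
            using i by (induction u) (simp_all add: h_simps M.m_assoc gM coord h_in)
          then show ?thesis
            using i coord h_in by (auto simp: monoid_hom_def hom_def free_monoid_def h_simps)
        qed
        then show "h (fst e) i = h (snd e) i"
          using e by (auto simp: equational_theory_def satisfies_def)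
      qed
      then show "\<psi> (fst e) = \<psi> (snd e)" using fh by metis
    qed
  qed
  then show "e \<in> equational_theory (variety M :: 'b monoid set)"
    by (simp add: equational_theory_def)
qed

lemma variety_refl:
  fixes M :: "'a monoid"
  assumes M: "monoid M"
  shows "M \<in> variety M"
proof -
  interpret M: monoid M by (rule M)
  let ?I = "{\<lambda>x. x} :: ('a \<Rightarrow> 'a) set"
  let ?P = "product_group ?I (\<lambda>_. M)"
  have "submonoid (carrier ?P) ?P"
    by unfold_locales auto
  moreover have "(\<lambda>s. s (\<lambda>x. x)) \<in> monoid_hom (?P\<lparr>carrier := carrier ?P\<rparr>) M"
    by (auto simp: monoid_hom_def hom_def)
  moreover have "(\<lambda>s. s (\<lambda>x. x)) ` carrier ?P = carrier M"
  proof
    show "carrier M \<subseteq> (\<lambda>s. s (\<lambda>x. x)) ` carrier ?P"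
    proof
      fix a assume "a \<in> carrier M"
      then show "a \<in> (\<lambda>s. s (\<lambda>x. x)) ` carrier ?P"
        by (intro image_eqI[where x = "\<lambda>i\<in>?I. a"]) auto
    qed
  qed auto
  ultimately show ?thesis
    using M unfolding variety_def by blast
qed

lemma equational_theory_variety:
  fixes M :: "'a monoid"
  assumes "monoid M"
  shows "equational_theory (variety M :: 'a monoid set) = equational_theory {M}"
  using equational_theory_variety_superset[OF assms] variety_refl[OF assms]
  by (auto simp: equational_theory_def)

end

theory Submission
  imports Defs
begin

text \<open>The two identities allow exactly the swaps of adjacent distinct letters that are neither both
  first nor both last occurrences. If \<open>u = a u'\<close> and \<open>v\<close> have equal content, first occurrences and
  last occurrences, then the leftmost \<open>a\<close> of \<open>v\<close> moves to the front by such swaps: a forbidden swap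
  with a letter \<open>b\<close> would mean that \<open>b\<close> precedes \<open>a\<close> among the first or the last occurrences of \<open>v\<close>,
  but not of \<open>u\<close>. Then one continues with the remaining letters, where letters that were already
  processed do not count as first occurrences any more. Conversely, an identity of \<open>mSt\<close> has the
  same content, first and last occurrences on both sides, as one sees by sending its variables to
  distinct generators.\<close>

section \<open>First and last occurrences under maps, filters and concatenation\<close>

lemma count_list_map_inj_on:
  assumes "inj_on f (insert a (set u))"
  shows "count_list (map f u) (f a) = count_list u a"
  using assms by (induction u) (auto simp: inj_on_def)

lemma remdups_map_inj_on:
  assumes "inj_on f (set u)"
  shows "remdups (map f u) = map f (remdups u)"
  using assms by (induction u) (auto simp: inj_on_def)

lemma first_occurrences_filter: "first_occurrences (filter P u) = filter P (first_occurrences u)"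
  by (simp add: first_occurrences_def rev_filter remdups_filter)

lemma set_first_occurrences [simp]: "set (first_occurrences u) = set u"
  by (simp add: first_occurrences_def)

lemma set_last_occurrences [simp]: "set (last_occurrences u) = set u"
  by (simp add: last_occurrences_def)

lemma first_occurrences_Cons:
  "first_occurrences (a # u) = a # filter (\<lambda>b. b \<noteq> a) (first_occurrences u)"
proof -
  have "remdups (w @ [a]) = filter (\<lambda>b. b \<noteq> a) (remdups w) @ [a]" for w
    by (induction w) auto
  then show ?thesis
    by (simp add: first_occurrences_def rev_filter)
qed

lemma last_occurrences_append:
  "last_occurrences (u @ v) = filter (\<lambda>a. a \<notin> set v) (last_occurrences u) @ last_occurrences v"
  by (induction u) (auto simp: last_occurrences_def)

lemma first_occurrences_append:
  "first_occurrences (u @ v) = first_occurrences u @ filter (\<lambda>a. a \<notin> set u) (first_occurrences v)"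
  using last_occurrences_append[of "rev v" "rev u"]
  by (simp add: first_occurrences_def last_occurrences_def rev_filter)

section \<open>Identities of the meet-stalactic monoid\<close>

lemma mst_class_eq_iff:
  assumes "u \<in> lists {1..}" "v \<in> lists {1..}"
  shows "mst_cong `` {u} = mst_cong `` {v} \<longleftrightarrow> (u, v) \<in> mst_cong"
  using eq_equiv_class_iff[OF equiv_mst_cong] assms by blast

text \<open>A morphism from a free monoid is determined by the images of the variables, so choosing
  a representative word for each image turns it into a substitution.\<close>

lemma mSt_hom_concat:
  assumes "\<psi> \<in> monoid_hom (free_monoid UNIV) mSt"
  obtains W where "\<And>x. W x \<in> lists {1..}" "\<And>u. \<psi> u = mst_cong `` {concat (map W u)}"
proof -
  have "\<forall>x. \<exists>w. w \<in> lists {1..} \<and> \<psi> [x] = mst_cong `` {w}"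
  proof
    fix x
    have "\<psi> [x] \<in> lists {1..} // mst_cong"
      using assms by (auto simp: monoid_hom_def hom_def free_monoid_def mSt_def)
    then show "\<exists>w. w \<in> lists {1..} \<and> \<psi> [x] = mst_cong `` {w}"
      by (auto elim!: quotientE)
  qed
  then obtain W where W: "W x \<in> lists {1..}" "\<psi> [x] = mst_cong `` {W x}" for x
    by metis
  have closed: "concat (map W u) \<in> lists {1..}" for u
    using W(1) by (induction u) auto
  have "\<psi> u = mst_cong `` {concat (map W u)}" for u
  proof (induction u)
    case Nil
    then show ?case
      using assms by (auto simp: monoid_hom_def free_monoid_def mSt_def)
  next
    case (Cons x u)
    have "\<psi> (v @ w) = \<psi> v \<otimes>\<^bsub>mSt\<^esub> \<psi> w" for v w
      using assms by (simp add: monoid_hom_def hom_def free_monoid_def)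
    from this[of "[x]" u] have "\<psi> (x # u) = \<psi> [x] \<otimes>\<^bsub>mSt\<^esub> \<psi> u"
      by simp
    then show ?case
      using Cons W mSt_mult[OF W(1) closed] by simp
  qed
  then show thesis
    using W(1) that by blast
qed

lemma mSt_satisfiesI:
  assumes "\<And>W :: 'v \<Rightarrow> nat list. (\<And>x. W x \<in> lists {1..}) \<Longrightarrow>
    (concat (map W u), concat (map W v)) \<in> mst_cong"
  shows "satisfies mSt (u, v)"
  unfolding satisfies_def
proof
  fix \<psi> :: "'v list \<Rightarrow> nat list set"
  assume "\<psi> \<in> monoid_hom (free_monoid UNIV) mSt"
  then obtain W where "\<And>x. W x \<in> lists {1..}" "\<And>u. \<psi> u = mst_cong `` {concat (map W u)}"
    using mSt_hom_concat by metis
  then show "\<psi> (fst (u, v)) = \<psi> (snd (u, v))"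
    using equiv_class_eq[OF equiv_mst_cong assms] by simp
qed

lemma mSt_satisfiesD:
  assumes "satisfies mSt (u, v)"
  shows "count_list u a = count_list v a"
    and "first_occurrences u = first_occurrences v"
    and "last_occurrences u = last_occurrences v"
proof -
  \<comment> \<open>Finitely many letters matter, so any alphabet will do; \<open>a\<close> is
    included because it may occur in neither word. \<open>Suc\<close> below makes the generators
    start at 1.\<close>
  obtain g :: "'a \<Rightarrow> nat" where g: "inj_on g (set (a # u @ v))"
    using finite_imp_inj_to_nat_seg[of "set (a # u @ v)"] by auto
  define f where "f = Suc \<circ> g"
  have f: "inj_on f (set (a # u @ v))"
    using g by (auto simp: f_def inj_on_def)
  have f_mem: "map f w \<in> lists {1..}" for w
    by (auto simp: f_def)
  have "(\<lambda>w. mst_cong `` {map f w}) \<in> monoid_hom (free_monoid UNIV) mSt"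
    using mSt_mult[OF f_mem f_mem] quotientI[OF f_mem]
    by (auto simp: monoid_hom_def hom_def free_monoid_def) (auto simp: mSt_def)
  then have "mst_cong `` {map f u} = mst_cong `` {map f v}"
    using assms by (auto simp: satisfies_def)
  then have cong: "(map f u, map f v) \<in> mst_cong"
    using mst_class_eq_iff[OF f_mem f_mem] by simp
  have inj: "inj_on f (insert a (set u))" "inj_on f (insert a (set v))"
    "inj_on f (set u)" "inj_on f (set v)" "inj_on f (set u \<union> set v)"
    by (rule inj_on_subset[OF f]; auto)+
  show "count_list u a = count_list v a"
    using cong count_list_map_inj_on[OF inj(1)] count_list_map_inj_on[OF inj(2)]
    by (simp add: mst_cong_def)
  show "first_occurrences u = first_occurrences v"
    using cong inj by (simp add: mst_cong_def first_occurrences_def rev_map remdups_map_inj_on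
        inj_on_map_eq_map)
  show "last_occurrences u = last_occurrences v"
    using cong inj by (simp add: mst_cong_def last_occurrences_def remdups_map_inj_on
        inj_on_map_eq_map)
qed


section \<open>Rewriting with the two identities\<close>

lemma fully_invariant_congruence_subst:
  assumes "fully_invariant_congruence R" "(u, v) \<in> R"
  shows "(concat (map \<sigma> u), concat (map \<sigma> v)) \<in> R"
proof -
  have "(\<lambda>w. concat (map \<sigma> w)) \<in> monoid_hom (free_monoid UNIV) (free_monoid UNIV)"
    by (auto simp: monoid_hom_def hom_def free_monoid_def)
  moreover have "\<forall>\<phi> \<in> monoid_hom (free_monoid UNIV) (free_monoid UNIV). (\<phi> u, \<phi> v) \<in> R"
    using assms by (simp add: fully_invariant_congruence_def)
  ultimately show ?thesis
    by (rule bspec[rotated])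
qed

text \<open>\<open>consequences\<close> is an intersection, so completeness is proved in each fully
  invariant congruence containing the two identities.\<close>

locale meet_stalactic_congruence =
  fixes R :: "('v list \<times> 'v list) set" and x y z t :: 'v
  assumes fic: "fully_invariant_congruence R"
    and dist: "distinct [x, y, z, t]"
    and id1: "([x, z, x, y, t, y], [x, z, y, x, t, y]) \<in> R"
    and id2: "([x, z, x, y, t, x], [x, z, y, x, t, x]) \<in> R"
begin

lemma R_refl: "(u, u) \<in> R"
  using fic by (auto simp: fully_invariant_congruence_def equiv_def refl_on_def)

lemma R_sym: "(u, v) \<in> R \<Longrightarrow> (v, u) \<in> R"
  using fic by (auto simp: fully_invariant_congruence_def equiv_def dest: symD)

lemma R_trans: "(u, v) \<in> R \<Longrightarrow> (v, w) \<in> R \<Longrightarrow> (u, w) \<in> R"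
  using fic by (auto simp: fully_invariant_congruence_def equiv_def dest: transD)

lemma R_append: "(u, u') \<in> R \<Longrightarrow> (v, v') \<in> R \<Longrightarrow> (u @ v, u' @ v') \<in> R"
  using fic by (simp add: fully_invariant_congruence_def)

lemma R_context: "(u, v) \<in> R \<Longrightarrow> (p @ u @ q, p @ v @ q) \<in> R"
  by (intro R_append R_refl)

text \<open>The earlier \<open>a\<close> plays the leading \<open>x\<close>; \<open>z\<close> and
  \<open>t\<close> absorb the gaps to the earlier and later copies, and may be empty.\<close>

lemma swap_if_mem_prefix:
  assumes "a \<in> set p" "a \<in> set q \<or> b \<in> set q"
  shows "(p @ a # b # q, p @ b # a # q) \<in> R"
proof -
  obtain p1 p2 where p: "p = p1 @ a # p2"
    using assms(1) by (meson split_list)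
  show ?thesis
    using assms(2)
  proof
    assume "a \<in> set q"
    then obtain q1 q2 where q: "q = q1 @ a # q2"
      by (meson split_list)
    show ?thesis
      using R_context[OF fully_invariant_congruence_subst[OF fic id2,
          of "(\<lambda>_. [])(x := [a], y := [b], z := p2, t := q1)"], of p1 q2] dist
      by (auto simp: p q)
  next
    assume "b \<in> set q"
    then obtain q1 q2 where q: "q = q1 @ b # q2"
      by (meson split_list)
    show ?thesis
      using R_context[OF fully_invariant_congruence_subst[OF fic id1,
          of "(\<lambda>_. [])(x := [a], y := [b], z := p2, t := q1)"], of p1 q2] dist
      by (auto simp: p q)
  qed
qed

lemma swap:
  assumes "a \<in> set p \<or> b \<in> set p" "a \<in> set q \<or> b \<in> set q"
  shows "(p @ a # b # q, p @ b # a # q) \<in> R"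
  using assms(1)
proof
  assume "a \<in> set p"
  then show ?thesis
    using assms(2) by (rule swap_if_mem_prefix)
next
  assume "b \<in> set p"
  then have "(p @ b # a # q, p @ a # b # q) \<in> R"
    using assms(2) by (intro swap_if_mem_prefix) auto
  then show ?thesis
    by (rule R_sym)
qed

text \<open>The letter \<open>a\<close> crosses \<open>v\<close> from right to left, one
  \<open>swap\<close> at a time; each crossed letter joins the suffix, which preserves the second
  hypothesis.\<close>

lemma move_left:
  assumes "a \<notin> set p \<Longrightarrow> set v \<subseteq> set p" "a \<notin> set q \<Longrightarrow> set v \<subseteq> set q"
  shows "(p @ v @ a # q, p @ a # v @ q) \<in> R"
  using assms
proof (induction v arbitrary: q rule: rev_induct)
  case Nil
  show ?case
    by (simp add: R_refl)
next
  case (snoc b v)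
  have "((p @ v) @ b # a # q, (p @ v) @ a # b # q) \<in> R"
    using snoc.prems by (intro swap) auto
  then have "(p @ (v @ [b]) @ a # q, p @ v @ a # b # q) \<in> R"
    by simp
  moreover have "(p @ v @ a # b # q, p @ a # v @ b # q) \<in> R"
    using snoc.prems by (intro snoc.IH) auto
  ultimately have "(p @ (v @ [b]) @ a # q, p @ a # v @ b # q) \<in> R"
    by (rule R_trans)
  then show ?case
    by simp
qed

text \<open>Only the letters outside the common prefix \<open>p\<close> have their first occurrences in \<open>u\<close> and \<open>v\<close>;
  this is what makes the induction go through.\<close>

lemma congruent_if_same_occurrences_after_prefix:
  assumes "\<And>a. count_list u a = count_list v a"
    and "last_occurrences u = last_occurrences v"
    and "first_occurrences (filter (\<lambda>a. a \<notin> set p) u) =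
         first_occurrences (filter (\<lambda>a. a \<notin> set p) v)"
  shows "(p @ u, p @ v) \<in> R"
  using assms
proof (induction u arbitrary: p v)
  case Nil
  then have "v = []"
    by (simp add: last_occurrences_def)
  then show ?case
    by (simp add: R_refl)
next
  case (Cons a u)
  have set_eq: "set (a # u) = set v"
    using Cons.prems(2) by (metis last_occurrences_def set_remdups)
  then have "a \<in> set v"
    by auto
  then obtain v1 v2 where v: "v = v1 @ a # v2" and a_v1: "a \<notin> set v1"
    by (meson split_list_first)
  have count_eq: "count_list u b = count_list (v1 @ v2) b" for b
    using Cons.prems(1)[of b] by (auto simp: v split: if_splits)
  then have a_mem: "a \<in> set u \<longleftrightarrow> a \<in> set v2"
    using a_v1 by (metis count_list_0_iff Un_iff set_append)
  \<comment> \<open>Otherwise the first letter of \<open>v1\<close> outside \<open>p\<close> would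
    head the first occurrences of \<open>v\<close>, where \<open>a # u\<close> forces
    \<open>a\<close>.\<close>
  have v1_p: "set v1 \<subseteq> set p" if "a \<notin> set p"
  proof (rule ccontr)
    assume "\<not> set v1 \<subseteq> set p"
    then have "filter (\<lambda>a. a \<notin> set p) v1 \<noteq> []"
      by (auto simp: filter_empty_conv)
    then obtain b w where bw: "filter (\<lambda>a. a \<notin> set p) v1 = b # w"
      by (cases "filter (\<lambda>a. a \<notin> set p) v1") auto
    then have "b \<in> set v1"
      by (metis filter_is_subset list.set_intros(1) subset_iff)
    moreover have "a = b"
      using Cons.prems(3) that by (simp add: v bw first_occurrences_Cons)
    ultimately show False
      using a_v1 by simp
  qed
  \<comment> \<open>If \<open>a\<close> does not recur, it heads the last occurrences of
    \<open>a # u\<close>; a letter of \<open>v1\<close> missing from \<open>v2\<close> would precede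
    it in those of \<open>v\<close>.\<close>
  have v1_v2: "set v1 \<subseteq> set v2" if "a \<notin> set v2"
  proof
    fix b assume b: "b \<in> set v1"
    show "b \<in> set v2"
    proof (rule ccontr)
      assume "b \<notin> set v2"
      define w where "w = filter (\<lambda>c. c \<notin> set (a # v2)) (last_occurrences v1)"
      have w: "b \<in> set w" "a \<notin> set w"
        using b a_v1 \<open>b \<notin> set v2\<close> by (auto simp: w_def)
      have "a # last_occurrences u = w @ last_occurrences (a # v2)"
        using Cons.prems(2) that a_mem
        by (simp add: v w_def last_occurrences_append) (simp add: last_occurrences_def)
      with w show False
        by (cases w) auto
    qed
  qed
  have "(p @ v, p @ a # v1 @ v2) \<in> R"
    unfolding v using v1_p v1_v2 by (rule move_left)
  then have "(p @ a # v1 @ v2, p @ v) \<in> R"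
    by (rule R_sym)
  moreover have "((p @ [a]) @ u, (p @ [a]) @ v1 @ v2) \<in> R"
  proof (rule Cons.IH)
    show "count_list u b = count_list (v1 @ v2) b" for b
      by (rule count_eq)
    \<comment> \<open>Deleting the leftmost \<open>a\<close> matters only if it is also the last
      one; then all of \<open>v1\<close> recurs in \<open>v2\<close>, so \<open>a\<close> is the
      head of the list.\<close>
    have "last_occurrences (v1 @ a # v2) =
      (if a \<in> set v2 then [] else [a]) @ last_occurrences (v1 @ v2)"
    proof (cases "a \<in> set v2")
      case True
      then have "insert a (set v2) = set v2"
        by auto
      with True show ?thesis
        by (simp add: last_occurrences_append) (simp add: last_occurrences_def)
    next
      case False
      then have "\<forall>b\<in>set v1. b \<in> set v2"
        using v1_v2 by blast
      with False show ?thesis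
        by (simp add: last_occurrences_append) (simp add: last_occurrences_def)
    qed
    then show "last_occurrences u = last_occurrences (v1 @ v2)"
      using Cons.prems(2) a_mem by (auto simp: v) (auto simp: last_occurrences_def)
    \<comment> \<open>Adding \<open>a\<close> to the prefix just deletes \<open>a\<close> from the
      remaining first occurrences, so the third hypothesis passes to the shorter words.\<close>
    have filter_eq: "first_occurrences (filter (\<lambda>b. b \<notin> set (p @ [a])) w) =
      filter (\<lambda>b. b \<noteq> a) (first_occurrences (filter (\<lambda>b. b \<notin> set p) w))" for w
      by (auto simp: first_occurrences_filter intro!: filter_cong)
    show "first_occurrences (filter (\<lambda>b. b \<notin> set (p @ [a])) u) =
      first_occurrences (filter (\<lambda>b. b \<notin> set (p @ [a])) (v1 @ v2))"
      using arg_cong[OF Cons.prems(3), of "filter (\<lambda>b. b \<noteq> a)"]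
      unfolding filter_eq[symmetric] v by simp
  qed
  then have "(p @ a # u, p @ a # v1 @ v2) \<in> R"
    by simp
  ultimately show ?case
    using R_trans by blast
qed

end

theorem corollary7p7:
  fixes x y z t :: 'v
  assumes "distinct [x, y, z, t]"
  shows "let B = {([x, z, x, y, t, y], [x, z, y, x, t, y]),
                  ([x, z, x, y, t, x], [x, z, y, x, t, x])}
         in finite B \<and> equational_basis (variety mSt :: nat list set monoid set) B"
proof -
  let ?B = "{([x, z, x, y, t, y], [x, z, y, x, t, y]),
             ([x, z, x, y, t, x], [x, z, y, x, t, x])}"
  have theory_eq: "equational_theory (variety mSt :: nat list set monoid set) =
    (equational_theory {mSt} :: ('v list \<times> 'v list) set)"
    by (rule equational_theory_variety[OF mSt_monoid])
  \<comment> \<open>In both identities the swapped \<open>W x\<close> contributes no first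
    occurrences, as \<open>W x\<close> came before, and one of the swapped blocks contributes no
    last ones, as it recurs after \<open>W t\<close>.\<close>
  have "satisfies mSt ([x, z, x, y, t, y], [x, z, y, x, t, y])"
  proof (rule mSt_satisfiesI)
    fix W :: "'v \<Rightarrow> nat list" assume "\<And>x. W x \<in> lists {1..}"
    then show "(concat (map W [x, z, x, y, t, y]), concat (map W [x, z, y, x, t, y])) \<in> mst_cong"
      by (simp add: mst_cong_def last_occurrences_append first_occurrences_append Un_ac
          conj_ac cong: conj_cong)
  qed
  moreover have "satisfies mSt ([x, z, x, y, t, x], [x, z, y, x, t, x])"
  proof (rule mSt_satisfiesI)
    fix W :: "'v \<Rightarrow> nat list" assume "\<And>x. W x \<in> lists {1..}"
    then show "(concat (map W [x, z, x, y, t, x]), concat (map W [x, z, y, x, t, x])) \<in> mst_cong"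
      by (simp add: mst_cong_def last_occurrences_append first_occurrences_append Un_ac
          conj_ac cong: conj_cong)
  qed
  ultimately have sound: "?B \<subseteq> equational_theory {mSt}"
    by (simp add: equational_theory_def)
  have complete: "equational_theory {mSt} \<subseteq> consequences ?B"
  proof
    fix e :: "'v list \<times> 'v list" assume "e \<in> equational_theory {mSt}"
    moreover obtain u v where e: "e = (u, v)"
      by fastforce
    ultimately have sat: "satisfies mSt (u, v)"
      by (simp add: equational_theory_def)
    have "(u, v) \<in> R" if "fully_invariant_congruence R" "?B \<subseteq> R" for R
    proof -
      interpret meet_stalactic_congruence R x y z t
        using that assms by unfold_locales auto
      \<comment> \<open>With the empty prefix the filters are trivial, and the hypotheses are
        exactly the three invariants of an identity of \<open>mSt\<close>.\<close>
      show ?thesis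
        using congruent_if_same_occurrences_after_prefix[of u v "[]"] mSt_satisfiesD[OF sat] by simp
    qed
    then show "e \<in> consequences ?B"
      by (simp add: consequences_def e)
  qed
  show ?thesis
    using sound complete by (simp add: equational_basis_def theory_eq)
qed

end
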